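(* Let $G$ be a connected graph on $n \geq 3$ vertices with constant resistance curvature. Then $G$ is 2-connected.
   Context: All graphs are finite, simple and undirected. For a connected graph $G$ and vertices $i,j$, the resistance distance $\Omega_G(i,j)$ is the effective resistance between $i$ and $j$ in the electrical network obtained from $G$ by replacing each edge with a unit resistor. The resistance matrix $R_G$ is the $n\times n$ matrix with $(i,j)$-entry $\Omega_G(i,j)$; it is nonsingular. The resistance curvature vector $\kappa=(\kappa_1,\dots,\kappa_n)^T$ is the unique solution of $R_G\kappa=\mathbf{1}$, where $\mathbf{1}$ is the all-ones vector; $\kappa_i$ is the resistance curvature at vertex $v_i$. $G$ has constant resistance curvature if all $\kappa_i$ are equal. A graph is 2-connected if it is connected, has at least three vertices, and has no cut vertex (a vertex whose deletion disconnects the graph). *)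

theory Defs
  imports Complex_Main "HOL-Library.FuncSet" "Graph_Theory.Digraph_Component"
begin

text \<open>
  A finite simple undirected graph is a \<^locale>\<open>graph\<close>: every undirected edge is a pair of
  opposite arcs, so the edges at a vertex \<open>k\<close> correspond bijectively to \<open>out_arcs G k\<close>.

  \<open>p\<close> is an electric potential for the network of unit resistors in which one unit of current
  enters at \<open>i\<close> and leaves at \<open>j\<close>. By Ohm's law the current through a unit resistor is the
  potential drop along it; Kirchhoff's current law says that the net current leaving \<open>k\<close> through
  the resistors is the external current fed in at \<open>k\<close>.
\<close>

definition unit_current_potential ::
    "('a, 'b) pre_digraph \<Rightarrow> 'a \<Rightarrow> 'a \<Rightarrow> ('a \<Rightarrow> real) \<Rightarrow> bool" where
  "unit_current_potential G i j p \<longleftrightarrow>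
     (\<forall>k\<in>verts G. (\<Sum>e\<in>out_arcs G k. p (tail G e) - p (head G e))
                    = of_bool (k = i) - of_bool (k = j))"

text \<open>
  In a connected graph the potential is unique up to an additive constant, so the potential
  difference between \<open>i\<close> and \<open>j\<close> is well defined for vertices \<open>i\<close>, \<open>j\<close>.
\<close>

definition resistance_distance :: "('a, 'b) pre_digraph \<Rightarrow> 'a \<Rightarrow> 'a \<Rightarrow> real" where
  "resistance_distance G i j =
     (THE r. \<exists>p. unit_current_potential G i j p \<and> r = p i - p j)"

text \<open>
  Matrices and vectors are indexed by the vertex set itself: the resistance matrix has entries
  \<open>resistance_distance G i j\<close> for \<open>i, j \<in> verts G\<close>, and the curvature vector is a function on
  \<open>verts G\<close>, made unique as a HOL function by extensionality outside \<open>verts G\<close>.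
\<close>

definition resistance_curvature :: "('a, 'b) pre_digraph \<Rightarrow> 'a \<Rightarrow> real" where
  "resistance_curvature G =
     (THE \<kappa>. \<kappa> \<in> extensional (verts G) \<and>
        (\<forall>i\<in>verts G. (\<Sum>j\<in>verts G. resistance_distance G i j * \<kappa> j) = 1))"

definition constant_resistance_curvature :: "('a, 'b) pre_digraph \<Rightarrow> bool" where
  "constant_resistance_curvature G \<longleftrightarrow>
     (\<forall>i\<in>verts G. \<forall>j\<in>verts G. resistance_curvature G i = resistance_curvature G j)"

definition cut_vertex :: "('a, 'b) pre_digraph \<Rightarrow> 'a \<Rightarrow> bool" where
  "cut_vertex G v \<longleftrightarrow>
     v \<in> verts G \<and> \<not> Digraph_Component.connected (pre_digraph.del_vert G v)"

definition two_connected :: "('a, 'b) pre_digraph \<Rightarrow> bool" where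
  "two_connected G \<longleftrightarrow>
     Digraph_Component.connected G \<and> card (verts G) \<ge> 3 \<and> (\<nexists>v. cut_vertex G v)"

end

theory Submission
  imports Defs
begin

text \<open>
  Energy arguments give positivity and the triangle inequality for the resistance distance
  \<open>\<Omega>\<close>, and show that \<open>\<Sum>i j. x i * \<Omega> i j * x j < 0\<close> whenever \<open>x\<close> is nonzero with sum zero.
  Hence the resistance matrix is nonsingular, and constant curvature means that all its row sums
  agree. Suppose that a cut vertex \<open>v\<close> separates \<open>A\<close> from \<open>B\<close>, and let \<open>u \<in> A\<close>. Since
  \<open>\<Omega> u z = \<Omega> u v + \<Omega> v z\<close> for \<open>z \<in> B\<close>, equality of the row sums at \<open>u\<close> and \<open>v\<close> reads
  \<open>(\<Sum>z\<in>A. \<Omega> u z) + (1 + card B) * \<Omega> u v = (\<Sum>z\<in>A. \<Omega> v z)\<close>, and the triangle inequality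
  yields \<open>1 + card B \<le> card A\<close>. By symmetry also \<open>1 + card A \<le> card B\<close>, a contradiction.
\<close>

section \<open>Finite systems of linear equations\<close>

text \<open>Gaussian elimination, one equation at a time: a zero equation is dropped, any other one
  is used to eliminate a pivot unknown.\<close>

lemma homogeneous_system_nontrivial_solution:
  fixes a :: "'i \<Rightarrow> 'j \<Rightarrow> 'f::field"
  assumes "finite I" "finite J" "card I < card J"
  shows "\<exists>x. (\<exists>j\<in>J. x j \<noteq> 0) \<and> (\<forall>i\<in>I. (\<Sum>j\<in>J. a i j * x j) = 0)"
  using assms
proof (induction I arbitrary: J a rule: finite_induct)
  case empty
  then obtain j where "j \<in> J"
    by (auto simp: card_gt_0_iff)
  then show ?case
    by (intro exI[of _ "\<lambda>_. 1"]) auto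
next
  case (insert i I)
  show ?case
  proof (cases "\<forall>j\<in>J. a i j = 0")
    case True
    have "card I < card J"
      using insert by simp
    from insert.IH[OF \<open>finite J\<close> this, of a] obtain x
      where "\<exists>j\<in>J. x j \<noteq> 0" "\<forall>k\<in>I. (\<Sum>j\<in>J. a k j * x j) = 0"
      by blast
    with True show ?thesis
      by (intro exI[of _ x]) auto
  next
    case False
    then obtain m where m: "m \<in> J" "a i m \<noteq> 0"
      by blast
    define J' where "J' = J - {m}"
    \<comment> \<open>Row \<open>k\<close> minus the multiple of row \<open>i\<close> that clears
      the pivot column \<open>m\<close>.\<close>
    define a' where "a' k j = a k j - a k m * a i j / a i m" for k j
    have J': "finite J'" "card I < card J'" "J = insert m J'" "m \<notin> J'"
      using insert m by (auto simp: J'_def)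
    from insert.IH[OF J'(1,2), of a'] obtain x
      where x: "\<exists>j\<in>J'. x j \<noteq> 0" "\<forall>k\<in>I. (\<Sum>j\<in>J'. a' k j * x j) = 0"
      by blast
    define s where "s = (\<Sum>j\<in>J'. a i j * x j)"
    \<comment> \<open>Back substitution: equation \<open>i\<close> forces this value of the pivot
      unknown.\<close>
    define y where "y = x(m := - s / a i m)"
    have y: "(\<Sum>j\<in>J. a k j * y j) = (\<Sum>j\<in>J'. a k j * x j) - a k m * s / a i m" for k
    proof -
      have "(\<Sum>j\<in>J'. a k j * y j) = (\<Sum>j\<in>J'. a k j * x j)"
        using J' by (intro sum.cong) (auto simp: y_def)
      then show ?thesis
        using J' by (simp add: y_def)
    qed
    have "(\<Sum>j\<in>J'. a' k j * x j) = (\<Sum>j\<in>J'. a k j * x j) - a k m * s / a i m" for k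
      by (simp add: a'_def s_def algebra_simps sum_subtractf sum_distrib_left sum_divide_distrib)
    then have "\<forall>k\<in>I. (\<Sum>j\<in>J. a k j * y j) = 0"
      using x y by simp
    moreover have "(\<Sum>j\<in>J. a i j * y j) = 0"
      using y[of i] m by (simp add: s_def)
    moreover have "\<exists>j\<in>J. y j \<noteq> 0"
      using x J' by (auto simp: y_def)
    ultimately show ?thesis
      by (intro exI[of _ y]) auto
  qed
qed

lemma square_system_solvable:
  fixes a :: "'i \<Rightarrow> 'i \<Rightarrow> 'f::field"
  assumes "finite I"
    and inj: "\<And>x i. (\<And>k. k \<in> I \<Longrightarrow> (\<Sum>j\<in>I. a k j * x j) = 0) \<Longrightarrow> i \<in> I \<Longrightarrow> x i = 0"
  shows "\<exists>x. \<forall>i\<in>I. (\<Sum>j\<in>I. a i j * x j) = b i"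
proof -
  \<comment> \<open>The unknown \<open>None\<close> homogenizes the system.\<close>
  define J where "J = insert None (Some ` I)"
  define c where "c i j = (case j of None \<Rightarrow> - b i | Some k \<Rightarrow> a i k)" for i j
  have "finite J" "card I < card J"
    using \<open>finite I\<close> by (auto simp: J_def card_image)
  from homogeneous_system_nontrivial_solution[OF \<open>finite I\<close> this, of c] obtain x
    where x: "\<exists>j\<in>J. x j \<noteq> 0" "\<forall>i\<in>I. (\<Sum>j\<in>J. c i j * x j) = 0"
    by blast
  have "(\<Sum>j\<in>J. c i j * x j) = (\<Sum>j\<in>I. a i j * x (Some j)) - b i * x None" for i
    using \<open>finite I\<close> by (simp add: J_def c_def sum.reindex)
  with x have eq: "(\<Sum>j\<in>I. a i j * x (Some j)) = b i * x None" if "i \<in> I" for i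
    using that by simp
  have nz: "x None \<noteq> 0"
  proof
    assume 0: "x None = 0"
    then have "x (Some i) = 0" if "i \<in> I" for i
      using inj[of "\<lambda>i. x (Some i)"] eq that by simp
    with 0 x(1) show False
      by (auto simp: J_def)
  qed
  have "(\<Sum>j\<in>I. a i j * (x (Some j) / x None)) = b i" if "i \<in> I" for i
    using eq[OF that] nz by (simp add: sum_divide_distrib[symmetric])
  then show ?thesis
    by (intro exI[of _ "\<lambda>j. x (Some j) / x None"]) auto
qed

section \<open>Resistance in weighted networks\<close>

locale network =
  fixes V :: "'a set" and w :: "'a \<Rightarrow> 'a \<Rightarrow> real"
  assumes fin: "finite V"
    and w_sym: "\<And>k l. k \<in> V \<Longrightarrow> l \<in> V \<Longrightarrow> w k l = w l k"
    and w_nonneg: "\<And>k l. k \<in> V \<Longrightarrow> l \<in> V \<Longrightarrow> 0 \<le> w k l"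
    \<comment> \<open>Connectedness: a function that is constant along edges is constant.\<close>
    and conn: "\<And>(f :: 'a \<Rightarrow> real) a b. (\<And>k l. k \<in> V \<Longrightarrow> l \<in> V \<Longrightarrow> w k l > 0 \<Longrightarrow> f k = f l)
                 \<Longrightarrow> a \<in> V \<Longrightarrow> b \<in> V \<Longrightarrow> f a = f b"
begin

section \<open>The Laplacian and its energy form\<close>

definition lap :: "('a \<Rightarrow> real) \<Rightarrow> 'a \<Rightarrow> real" where
  "lap p k = (\<Sum>l\<in>V. w k l * (p k - p l))"

definition potential :: "'a \<Rightarrow> 'a \<Rightarrow> ('a \<Rightarrow> real) \<Rightarrow> bool" where
  "potential i j p \<longleftrightarrow> (\<forall>k\<in>V. lap p k = of_bool (k = i) - of_bool (k = j))"

definition res :: "'a \<Rightarrow> 'a \<Rightarrow> real" where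
  "res i j = (THE r. \<exists>p. potential i j p \<and> r = p i - p j)"

lemma lap_add: "lap (\<lambda>x. p x + q x) k = lap p k + lap q k"
  unfolding lap_def sum.distrib[symmetric] by (intro sum.cong) (auto simp: algebra_simps)

lemma lap_diff: "lap (\<lambda>x. p x - q x) k = lap p k - lap q k"
  unfolding lap_def sum_subtractf[symmetric] by (intro sum.cong) (auto simp: algebra_simps)

lemma lap_minus: "lap (\<lambda>x. - p x) k = - lap p k"
  unfolding lap_def sum_negf[symmetric] by (intro sum.cong) (auto simp: algebra_simps)

lemma lap_sum: "lap (\<lambda>x. \<Sum>j\<in>J. c j * g j x) k = (\<Sum>j\<in>J. c j * lap (g j) k)"
proof -
  have "lap (\<lambda>x. \<Sum>j\<in>J. c j * g j x) k = (\<Sum>l\<in>V. \<Sum>j\<in>J. c j * (w k l * (g j k - g j l)))"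
    by (simp add: lap_def sum_subtractf[symmetric] sum_distrib_left algebra_simps)
  also have "\<dots> = (\<Sum>j\<in>J. c j * lap (g j) k)"
    by (subst sum.swap) (simp add: lap_def sum_distrib_left)
  finally show ?thesis .
qed

text \<open>Summation by parts: exchanging \<open>k\<close> and \<open>l\<close> and using the
  symmetry of \<open>w\<close> gives a second form of the left-hand side, and the two are
  averaged.\<close>

lemma energy:
  "(\<Sum>k\<in>V. f k * lap p k) = (\<Sum>k\<in>V. \<Sum>l\<in>V. w k l * ((f k - f l) * (p k - p l))) / 2"
proof -
  have 1: "(\<Sum>k\<in>V. f k * lap p k) = (\<Sum>k\<in>V. \<Sum>l\<in>V. w k l * (f k * (p k - p l)))"
    by (simp add: lap_def sum_distrib_left mult_ac)
  also have "\<dots> = (\<Sum>k\<in>V. \<Sum>l\<in>V. w k l * (f l * (p l - p k)))"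
    by (subst sum.swap) (auto intro!: sum.cong simp: w_sym)
  finally have 2: "(\<Sum>k\<in>V. f k * lap p k) = \<dots>" .
  have "(\<Sum>k\<in>V. f k * lap p k) + (\<Sum>k\<in>V. f k * lap p k)
      = (\<Sum>k\<in>V. \<Sum>l\<in>V. w k l * ((f k - f l) * (p k - p l)))"
    by (subst 1, subst 2) (simp add: sum.distrib[symmetric] algebra_simps)
  then show ?thesis
    by simp
qed

lemma sum_lap: "(\<Sum>k\<in>V. lap p k) = 0"
  using energy[of "\<lambda>_. 1" p] by simp

lemma energy_nonneg: "0 \<le> (\<Sum>k\<in>V. f k * lap f k)"
  unfolding energy by (intro divide_nonneg_nonneg sum_nonneg mult_nonneg_nonneg[OF w_nonneg]) auto

text \<open>By \<open>mono\<close> every term of the energy sum is nonnegative, so all terms vanish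
  and \<open>f\<close> agrees along edges of positive weight. Two functions are allowed so that
  \<open>f\<close> can be a truncation of \<open>p\<close>.\<close>

lemma constant_if_cross_energy_nonpos:
  assumes le: "(\<Sum>k\<in>V. f k * lap p k) \<le> 0"
    and mono: "\<And>k l. (f k - f l)\<^sup>2 \<le> (f k - f l) * (p k - p l)"
    and "a \<in> V" "b \<in> V"
  shows "f a = f b"
proof (rule conn[of f, OF _ \<open>a \<in> V\<close> \<open>b \<in> V\<close>])
  fix k l
  assume kl: "k \<in> V" "l \<in> V" "w k l > 0"
  let ?E = "\<lambda>k l. w k l * ((f k - f l) * (p k - p l))"
  have nonneg: "0 \<le> ?E k l" if "k \<in> V" "l \<in> V" for k l
    using w_nonneg[OF that] order_trans[OF zero_le_power2 mono] by (rule mult_nonneg_nonneg)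
  have "?E k l \<le> (\<Sum>l\<in>V. ?E k l)"
    using kl fin nonneg by (intro member_le_sum) auto
  also have "\<dots> \<le> (\<Sum>k\<in>V. \<Sum>l\<in>V. ?E k l)"
    using kl fin nonneg by (intro member_le_sum[of k V "\<lambda>k. \<Sum>l\<in>V. ?E k l"]) (auto intro!: sum_nonneg)
  also have "\<dots> \<le> 0"
    using le unfolding energy by simp
  finally have "(f k - f l) * (p k - p l) \<le> 0"
    using kl by (simp add: mult_le_0_iff)
  with mono[of k l] have "(f k - f l)\<^sup>2 \<le> 0"
    by linarith
  then show "f k = f l"
    by simp
qed

lemma constant_if_energy_nonpos:
  assumes "(\<Sum>k\<in>V. f k * lap f k) \<le> 0" "a \<in> V" "b \<in> V"
  shows "f a = f b"
  by (rule constant_if_cross_energy_nonpos[OF assms(1) _ assms(2,3)]) (simp add: power2_eq_square)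

lemma lap_constant:
  assumes "\<And>a b. a \<in> V \<Longrightarrow> b \<in> V \<Longrightarrow> f a = f b" "k \<in> V"
  shows "lap f k = 0"
  unfolding lap_def by (intro sum.neutral ballI) (metis assms diff_self mult_zero_right)

section \<open>The Poisson equation\<close>

lemma poisson_solvable:
  assumes f: "(\<Sum>k\<in>V. f k) = 0"
  shows "\<exists>p. \<forall>k\<in>V. lap p k = f k"
proof -
  \<comment> \<open>Adding the all-ones matrix makes the Laplacian nonsingular.\<close>
  define M where "M k l = (if k = l then \<Sum>m\<in>V. w k m else 0) - w k l + 1" for k l
  have M: "(\<Sum>l\<in>V. M k l * x l) = lap x k + (\<Sum>l\<in>V. x l)" if "k \<in> V" for x k
  proof -
    have "(\<Sum>l\<in>V. (if k = l then \<Sum>m\<in>V. w k m else 0) * x l) = (\<Sum>m\<in>V. w k m) * x k"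
      using that fin by (simp add: if_distrib[of "\<lambda>z. z * _"] sum.delta cong: if_cong)
    then show ?thesis
      by (simp add: M_def lap_def algebra_simps sum.distrib sum_subtractf sum_distrib_left)
  qed
  \<comment> \<open>Adding up all equations cancels the Laplacian part by \<open>sum_lap\<close> and
    leaves \<open>card V\<close> times the sum of \<open>x\<close>. This serves both for injectivity
    (\<open>g = 0\<close>) and for the final solution (\<open>g = f\<close>).\<close>
  have zero_sum: "(\<Sum>l\<in>V. x l) = 0"
    if "\<And>k. k \<in> V \<Longrightarrow> lap x k + (\<Sum>l\<in>V. x l) = g k" "(\<Sum>k\<in>V. g k) = 0" for x g
  proof -
    have "(\<Sum>k\<in>V. lap x k + (\<Sum>l\<in>V. x l)) = 0"
      using that by simp
    then have "card V = 0 \<or> (\<Sum>l\<in>V. x l) = 0"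
      by (simp add: sum.distrib sum_lap)
    then show ?thesis
      using fin by auto
  qed
  have "\<exists>x. \<forall>k\<in>V. (\<Sum>l\<in>V. M k l * x l) = f k"
  proof (rule square_system_solvable[OF fin])
    fix x i
    assume "\<And>k. k \<in> V \<Longrightarrow> (\<Sum>l\<in>V. M k l * x l) = 0" and i: "i \<in> V"
    then have 1: "lap x k + (\<Sum>l\<in>V. x l) = 0" if "k \<in> V" for k
      using M that by simp
    have 2: "(\<Sum>l\<in>V. x l) = 0"
      using zero_sum[of x "\<lambda>_. 0"] 1 by simp
    have "x l = x i" if "l \<in> V" for l
      using 1 2 that i by (intro constant_if_energy_nonpos[of x]) auto
    then have "(\<Sum>l\<in>V. x l) = card V * x i"
      by simp
    with 2 i fin show "x i = 0"
      by auto
  qed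
  then obtain x where "\<forall>k\<in>V. (\<Sum>l\<in>V. M k l * x l) = f k"
    by blast
  then have x: "lap x k + (\<Sum>l\<in>V. x l) = f k" if "k \<in> V" for k
    using M that by simp
  then have "(\<Sum>l\<in>V. x l) = 0"
    using zero_sum f by blast
  with x show ?thesis
    by auto
qed

section \<open>Unit-current potentials and resistance as a metric\<close>

lemma sum_of_bool_eq: "i \<in> V \<Longrightarrow> (\<Sum>k\<in>V. of_bool (k = i) * f k) = (f i :: real)"
  using fin by (simp add: of_bool_def if_distrib[of "\<lambda>z. z * _"] sum.delta cong: if_cong)

lemma sum_of_bool: "i \<in> V \<Longrightarrow> (\<Sum>k\<in>V. of_bool (k = i) :: real) = 1"
  using sum_of_bool_eq[of i "\<lambda>_. 1"] by simp

lemma potential_exists: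
  assumes "i \<in> V" "j \<in> V"
  obtains p where "potential i j p"
proof -
  have "\<exists>p. \<forall>k\<in>V. lap p k = of_bool (k = i) - of_bool (k = j)"
    using assms by (intro poisson_solvable) (simp add: sum_subtractf sum_of_bool)
  then show thesis
    using that by (auto simp: potential_def)
qed

text \<open>For \<open>f = p\<close> this identifies the energy of the potential with its drop from
  \<open>i\<close> to \<open>j\<close>, that is, with the resistance.\<close>

lemma potential_sum:
  assumes "potential i j p" "i \<in> V" "j \<in> V"
  shows "(\<Sum>k\<in>V. f k * lap p k) = f i - f j"
proof -
  have "(\<Sum>k\<in>V. f k * lap p k) = (\<Sum>k\<in>V. of_bool (k = i) * f k - of_bool (k = j) * f k)"
    using assms by (intro sum.cong) (simp_all add: potential_def right_diff_distrib mult.commute)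
  then show ?thesis
    using assms by (simp add: sum_subtractf sum_of_bool_eq)
qed

text \<open>The difference of two potentials has zero Laplacian, hence is constant, so the
  description in \<open>res\<close> is unique.\<close>

lemma res_eq:
  assumes "potential i j p" "i \<in> V" "j \<in> V"
  shows "res i j = p i - p j"
  unfolding res_def
proof (rule the_equality)
  fix r
  assume "\<exists>q. potential i j q \<and> r = q i - q j"
  then obtain q where q: "potential i j q" "r = q i - q j"
    by blast
  have "q i - p i = q j - p j"
    using assms q
    by (intro constant_if_energy_nonpos[of "\<lambda>x. q x - p x"]) (auto simp: lap_diff potential_def)
  with q show "r = p i - p j"
    by simp
qed (use assms in blast)

lemma potential_minus: "potential i j p \<Longrightarrow> potential j i (\<lambda>x. - p x)"
  by (auto simp: potential_def lap_minus)

lemma potential_add: "potential i j p \<Longrightarrow> potential j k q \<Longrightarrow> potential i k (\<lambda>x. p x + q x)"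
  by (auto simp: potential_def lap_add)

lemma res_sym:
  assumes "i \<in> V" "j \<in> V"
  shows "res i j = res j i"
proof -
  obtain p where p: "potential i j p"
    using potential_exists assms by blast
  show ?thesis
    using res_eq[OF p] res_eq[OF potential_minus[OF p]] assms by simp
qed

lemma res_self: "i \<in> V \<Longrightarrow> res i i = 0"
  by (rule potential_exists[of i i]) (simp_all add: res_eq[of i i])

text \<open>Resistance is energy; were it not positive, the potential would be constant and no
  current could leave \<open>i\<close>.\<close>

lemma res_pos:
  assumes "i \<in> V" "j \<in> V" "i \<noteq> j"
  shows "0 < res i j"
proof (rule ccontr)
  assume le: "\<not> 0 < res i j"
  obtain p where p: "potential i j p"
    using potential_exists assms by blast
  have "(\<Sum>k\<in>V. p k * lap p k) \<le> 0"
    using le potential_sum[OF p] res_eq[OF p] assms by simp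
  then have "lap p i = 0"
    using constant_if_energy_nonpos[of p] assms by (intro lap_constant) blast+
  then show False
    using p assms by (simp add: potential_def)
qed

text \<open>
  The maximum principle, proved by testing the potential against its truncation at the sink.
\<close>

lemma potential_sink_le:
  assumes p: "potential i j p" and "i \<in> V" "j \<in> V" "k \<in> V"
  shows "p j \<le> p k"
proof -
  define f where "f x = min (p x - p j) 0" for x
  have "f k = f j"
  proof (rule constant_if_cross_energy_nonpos[of f p])
    \<comment> \<open>The sum equals \<open>f i - f j\<close>, where \<open>f j = 0\<close> and
      \<open>f i \<le> 0\<close>.\<close>
    show "(\<Sum>k\<in>V. f k * lap p k) \<le> 0"
      using potential_sum[OF p, of f] assms by (simp add: f_def)
    \<comment> \<open>Truncation is monotone and 1-Lipschitz, so \<open>f k - f l\<close> lies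
      between \<open>0\<close> and \<open>p k - p l\<close>.\<close>
    show "(f k - f l)\<^sup>2 \<le> (f k - f l) * (p k - p l)" for k l
    proof (cases "p k \<le> p l")
      case True
      then have "f k - f l \<le> 0" "p k - p l \<le> f k - f l"
        by (auto simp: f_def)
      then show ?thesis
        unfolding power2_eq_square by (rule mult_left_mono_neg[rotated])
    next
      case False
      then have "0 \<le> f k - f l" "f k - f l \<le> p k - p l"
        by (auto simp: f_def)
      then show ?thesis
        unfolding power2_eq_square by (intro mult_left_mono)
    qed
  qed (use assms in auto)
  then show ?thesis
    by (simp add: f_def min_def split: if_splits)
qed

lemma potential_le_source:
  assumes "potential i j p" "i \<in> V" "j \<in> V" "k \<in> V"
  shows "p k \<le> p i"
  using potential_sink_le[OF potential_minus[OF assms(1)] assms(3,2,4)] by simp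

text \<open>Superpose potentials \<open>p\<close> from \<open>i\<close> to \<open>j\<close> and
  \<open>q\<close> from \<open>j\<close> to \<open>k\<close>. From \<open>i\<close> to
  \<open>k\<close>, each drops by at most its full drop, since sinks are minimal and sources
  maximal.\<close>

lemma res_triangle:
  assumes "i \<in> V" "j \<in> V" "k \<in> V"
  shows "res i k \<le> res i j + res j k"
proof -
  obtain p q where p: "potential i j p" and q: "potential j k q"
    using potential_exists assms by metis
  show ?thesis
    using res_eq[OF p] res_eq[OF q] res_eq[OF potential_add[OF p q]]
      potential_sink_le[OF p, of k] potential_le_source[OF q, of i] assms by simp
qed

section \<open>Negative type and nonsingularity of the resistance matrix\<close>

text \<open>A unit source balanced by a uniform sink has zero sum. Up to additive constants, the
  \<open>g j\<close> are the columns of the pseudoinverse of the Laplacian.\<close>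

lemma green_functions_exist:
  obtains g where "\<And>j k. j \<in> V \<Longrightarrow> k \<in> V \<Longrightarrow> lap (g j) k = of_bool (k = j) - 1 / card V"
proof -
  have "\<forall>j. \<exists>p. j \<in> V \<longrightarrow> (\<forall>k\<in>V. lap p k = of_bool (k = j) - 1 / card V)"
  proof
    fix j
    show "\<exists>p. j \<in> V \<longrightarrow> (\<forall>k\<in>V. lap p k = of_bool (k = j) - 1 / card V)"
    proof (cases "j \<in> V")
      case True
      then have "card V \<noteq> 0"
        using fin by auto
      then have "(\<Sum>k\<in>V. of_bool (k = j) - 1 / card V) = (0 :: real)"
        using True by (simp add: sum_subtractf sum_of_bool)
      from poisson_solvable[OF this] show ?thesis
        by blast
    qed auto
  qed
  then show thesis
    using that by metis
qed

text \<open>Writing \<open>res\<close> through Green functions, the diagonal terms vanish against a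
  zero-sum \<open>x\<close>; what remains is \<open>-2\<close> times the energy of a solution
  \<open>y\<close> of \<open>lap y = x\<close>. Zero energy makes \<open>y\<close> constant, hence
  \<open>x\<close> zero.\<close>

lemma res_negative_type:
  assumes x: "(\<Sum>i\<in>V. x i) = 0"
  shows "(\<Sum>i\<in>V. x i * (\<Sum>j\<in>V. res i j * x j)) \<le> 0"
    and "(\<Sum>i\<in>V. x i * (\<Sum>j\<in>V. res i j * x j)) = 0 \<Longrightarrow> k \<in> V \<Longrightarrow> x k = 0"
proof -
  obtain g where g: "\<And>j k. j \<in> V \<Longrightarrow> k \<in> V \<Longrightarrow> lap (g j) k = of_bool (k = j) - 1 / card V"
    using green_functions_exist by blast
  have res_g: "res i j = g i i - g j i - g i j + g j j" if "i \<in> V" "j \<in> V" for i j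
  proof -
    have "potential i j (\<lambda>x. g i x - g j x)"
      using that g by (auto simp: potential_def lap_diff)
    from res_eq[OF this] that show ?thesis
      by simp
  qed
  define y where "y k = (\<Sum>j\<in>V. x j * g j k)" for k
  have lap_y: "lap y k = x k" if "k \<in> V" for k
  proof -
    have "lap y k = (\<Sum>j\<in>V. x j * (of_bool (k = j) - 1 / card V))"
      unfolding y_def[abs_def] lap_sum using g that by simp
    also have "\<dots> = (\<Sum>j\<in>V. of_bool (j = k) * x j) - (\<Sum>j\<in>V. x j) / card V"
      by (simp add: algebra_simps sum_subtractf sum_divide_distrib eq_commute)
    finally show ?thesis
      using x that by (simp add: sum_of_bool_eq)
  qed
  have y: "(\<Sum>i\<in>V. \<Sum>j\<in>V. x i * x j * g j i) = (\<Sum>k\<in>V. y k * lap y k)"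
    by (simp add: lap_y y_def sum_distrib_right sum_distrib_left mult_ac)
  \<comment> \<open>The additive constants in \<open>g\<close> are arbitrary, so \<open>g\<close>
    need not be symmetric; only the double sums agree.\<close>
  have y': "(\<Sum>i\<in>V. \<Sum>j\<in>V. x i * x j * g i j) = (\<Sum>k\<in>V. y k * lap y k)"
    unfolding y[symmetric] by (subst sum.swap) (simp add: mult_ac)
  have "(\<Sum>i\<in>V. \<Sum>j\<in>V. x i * x j * g i i) = (\<Sum>i\<in>V. x i * g i i * (\<Sum>j\<in>V. x j))"
    unfolding sum_distrib_left by (intro sum.cong) (simp_all add: mult_ac)
  then have d: "(\<Sum>i\<in>V. \<Sum>j\<in>V. x i * x j * g i i) = 0"
    using x by simp
  then have d': "(\<Sum>i\<in>V. \<Sum>j\<in>V. x i * x j * g j j) = 0"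
    by (subst sum.swap) (simp add: mult_ac)
  have "(\<Sum>i\<in>V. x i * (\<Sum>j\<in>V. res i j * x j))
      = (\<Sum>i\<in>V. \<Sum>j\<in>V. x i * x j * g i i - x i * x j * g j i - x i * x j * g i j + x i * x j * g j j)"
    by (auto intro!: sum.cong simp: sum_distrib_left res_g algebra_simps)
  also have "\<dots> = - 2 * (\<Sum>k\<in>V. y k * lap y k)"
    by (simp add: sum.distrib sum_subtractf y y' d d')
  finally have eq: "(\<Sum>i\<in>V. x i * (\<Sum>j\<in>V. res i j * x j)) = - 2 * (\<Sum>k\<in>V. y k * lap y k)" .
  show "(\<Sum>i\<in>V. x i * (\<Sum>j\<in>V. res i j * x j)) \<le> 0"
    using energy_nonneg[of y] by (simp add: eq)
  assume "(\<Sum>i\<in>V. x i * (\<Sum>j\<in>V. res i j * x j)) = 0" and k: "k \<in> V"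
  then have "(\<Sum>k\<in>V. y k * lap y k) \<le> 0"
    by (simp add: eq)
  then have "lap y k = 0"
    using constant_if_energy_nonpos[of y] k by (intro lap_constant) blast+
  then show "x k = 0"
    using lap_y k by simp
qed

text \<open>Negative type only controls zero-sum vectors, so the point is to show that a kernel
  vector has zero sum.\<close>

lemma res_matrix_injective:
  assumes "card V \<ge> 2"
    and Rx: "\<And>i. i \<in> V \<Longrightarrow> (\<Sum>j\<in>V. res i j * x j) = 0"
    and k: "k \<in> V"
  shows "x k = 0"
proof -
  define s where "s = (\<Sum>i\<in>V. x i)"
  have "s = 0"
  proof (rule ccontr)
    assume s: "s \<noteq> 0"
    \<comment> \<open>The component of the all-ones vector with zero sum would have positive energy.\<close>
    define y where "y i = 1 - card V / s * x i" for i
    have "(\<Sum>i\<in>V. y i) = card V - card V / s * s"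
      by (simp add: y_def s_def sum_subtractf sum_distrib_left)
    then have "(\<Sum>i\<in>V. y i) = 0"
      using s by simp
    then have le: "(\<Sum>i\<in>V. y i * (\<Sum>j\<in>V. res i j * y j)) \<le> 0"
      by (rule res_negative_type)
    have Ry: "(\<Sum>j\<in>V. res i j * y j) = (\<Sum>j\<in>V. res i j)" if "i \<in> V" for i
    proof -
      have "(\<Sum>j\<in>V. res i j * y j) = (\<Sum>j\<in>V. res i j) - card V / s * (\<Sum>j\<in>V. res i j * x j)"
        by (simp add: y_def algebra_simps sum_subtractf sum_distrib_left)
      then show ?thesis
        using Rx that by simp
    qed
    \<comment> \<open>By symmetry of \<open>res\<close> the matrix can be moved onto
      \<open>x\<close>, which it annihilates; so the form at \<open>y\<close> is the sum of all
      matrix entries.\<close>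
    have "(\<Sum>i\<in>V. x i * (\<Sum>j\<in>V. res i j)) = (\<Sum>j\<in>V. \<Sum>i\<in>V. x i * res i j)"
      by (subst sum.swap) (simp add: sum_distrib_left)
    also have "\<dots> = (\<Sum>j\<in>V. \<Sum>i\<in>V. res j i * x i)"
      by (auto intro!: sum.cong simp: res_sym)
    finally have xR: "(\<Sum>i\<in>V. x i * (\<Sum>j\<in>V. res i j)) = 0"
      using Rx by simp
    have "(\<Sum>i\<in>V. y i * (\<Sum>j\<in>V. res i j * y j)) = (\<Sum>i\<in>V. y i * (\<Sum>j\<in>V. res i j))"
      by (simp add: Ry)
    also have "\<dots> = (\<Sum>i\<in>V. \<Sum>j\<in>V. res i j) - card V / s * (\<Sum>i\<in>V. x i * (\<Sum>j\<in>V. res i j))"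
      by (simp add: y_def left_diff_distrib sum_subtractf sum_divide_distrib[symmetric]
          sum_distrib_left[symmetric] mult.assoc)
    finally have total: "(\<Sum>i\<in>V. \<Sum>j\<in>V. res i j) \<le> 0"
      using le xR by simp
    have nonneg: "0 \<le> res i j" if "i \<in> V" "j \<in> V" for i j
      using res_pos[of i j] res_self[of i] that by (cases "i = j") auto
    obtain i j where ij: "i \<in> V" "j \<in> V" "i \<noteq> j"
      using \<open>card V \<ge> 2\<close> by (metis card_le_Suc0_iff_eq fin not_less_eq_eq numeral_2_eq_2)
    have "0 < res i j"
      using ij by (rule res_pos)
    also have "\<dots> \<le> (\<Sum>j\<in>V. res i j)"
      using ij fin nonneg by (intro member_le_sum) auto
    also have "\<dots> \<le> (\<Sum>i\<in>V. \<Sum>j\<in>V. res i j)"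
      using ij fin nonneg
      by (intro member_le_sum[of i V "\<lambda>i. \<Sum>j\<in>V. res i j"]) (auto intro!: sum_nonneg)
    finally show False
      using total by simp
  qed
  then show ?thesis
    using k Rx by (intro res_negative_type(2)[of x]) (auto simp: s_def)
qed

text \<open>Justifies the definite description in \<open>resistance_curvature\<close>.\<close>

lemma res_curvature_unique_existence:
  assumes "card V \<ge> 2"
  shows "\<exists>!\<kappa>. \<kappa> \<in> extensional V \<and> (\<forall>i\<in>V. (\<Sum>j\<in>V. res i j * \<kappa> j) = 1)"
proof (rule ex_ex1I)
  obtain x where x: "\<forall>i\<in>V. (\<Sum>j\<in>V. res i j * x j) = 1"
    using square_system_solvable[OF fin, of res "\<lambda>_. 1"] res_matrix_injective[OF assms] by blast
  then show "\<exists>\<kappa>. \<kappa> \<in> extensional V \<and> (\<forall>i\<in>V. (\<Sum>j\<in>V. res i j * \<kappa> j) = 1)"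
    by (intro exI[of _ "restrict x V"]) auto
next
  fix x y
  assume x: "x \<in> extensional V \<and> (\<forall>i\<in>V. (\<Sum>j\<in>V. res i j * x j) = 1)"
    and y: "y \<in> extensional V \<and> (\<forall>i\<in>V. (\<Sum>j\<in>V. res i j * y j) = 1)"
  show "x = y"
  proof (rule extensionalityI[of x V y])
    fix k
    assume "k \<in> V"
    then have "x k - y k = 0"
      using x y
      by (intro res_matrix_injective[OF assms, of "\<lambda>k. x k - y k"])
         (auto simp: right_diff_distrib sum_subtractf)
    then show "x k = y k"
      by simp
  qed (use x y in auto)
qed

section \<open>Resistance across a cut vertex\<close>

text \<open>No current needs to enter \<open>B\<close>: resetting a potential to its value at
  \<open>v\<close> on \<open>B\<close> is invisible from \<open>A\<close> and leaves no current
  inside \<open>B\<close>.\<close>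

lemma potential_constant_beyond_cut:
  assumes V: "V = insert v (A \<union> B)" "v \<notin> A" "v \<notin> B" "A \<inter> B = {}"
    and sep: "\<And>a b. a \<in> A \<Longrightarrow> b \<in> B \<Longrightarrow> w a b = 0"
    and u: "u \<in> A"
  obtains p where "potential u v p" "\<And>b. b \<in> B \<Longrightarrow> p b = p v"
proof -
  have uv: "u \<in> V" "v \<in> V" "u \<noteq> v"
    using V u by auto
  obtain q where q: "potential u v q"
    using potential_exists uv by blast
  define p where "p x = (if x \<in> B then q v else q x)" for x
  have "A \<subseteq> V"
    using V by auto
  have A: "lap p k = of_bool (k = u) - of_bool (k = v)" if "k \<in> A" for k
  proof -
    have "lap p k = lap q k"
      unfolding lap_def using V sep that by (intro sum.cong) (auto simp: p_def)
    then show ?thesis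
      using q \<open>A \<subseteq> V\<close> that by (auto simp: potential_def)
  qed
  have B: "lap p k = of_bool (k = u) - of_bool (k = v)" if "k \<in> B" for k
  proof -
    have "w k a = 0" if "a \<in> A" for a
      using sep[OF that \<open>k \<in> B\<close>] w_sym[of k a] V that \<open>k \<in> B\<close> by auto
    then have "lap p k = 0"
      unfolding lap_def using V that by (intro sum.neutral) (auto simp: p_def)
    then show ?thesis
      using V u that by auto
  qed
  have AB: "finite (A \<union> B)" "v \<notin> A \<union> B"
    using V fin by auto
  \<comment> \<open>Both sides sum to zero over \<open>V\<close> and agree off \<open>v\<close>, so
    they agree at \<open>v\<close> too.\<close>
  have "(\<Sum>k\<in>V. lap p k) = (\<Sum>k\<in>V. of_bool (k = u) - of_bool (k = v) :: real)"
    using uv by (simp add: sum_lap sum_subtractf sum_of_bool)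
  moreover have "(\<Sum>k\<in>A \<union> B. lap p k) = (\<Sum>k\<in>A \<union> B. of_bool (k = u) - of_bool (k = v))"
    using A B by (intro sum.cong) auto
  ultimately have "lap p v = of_bool (v = u) - of_bool (v = v)"
    using AB unfolding V(1) by simp
  with A B have "\<forall>k\<in>insert v (A \<union> B). lap p k = of_bool (k = u) - of_bool (k = v)"
    by blast
  then have "potential u v p"
    unfolding potential_def V(1)[symmetric] .
  then show thesis
    using V by (intro that[of p]) (auto simp: p_def)
qed

text \<open>A potential from \<open>u\<close> to \<open>v\<close> flat on \<open>B\<close> and one
  from \<open>v\<close> to \<open>z\<close> flat on \<open>A\<close> superpose to one from
  \<open>u\<close> to \<open>z\<close>, and their drops add.\<close>

lemma res_add_across_cut:
  assumes V: "V = insert v (A \<union> B)" "v \<notin> A" "v \<notin> B" "A \<inter> B = {}"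
    and sep: "\<And>a b. a \<in> A \<Longrightarrow> b \<in> B \<Longrightarrow> w a b = 0"
    and u: "u \<in> A" and z: "z \<in> B"
  shows "res u z = res u v + res v z"
proof -
  obtain p where p: "potential u v p" "\<And>b. b \<in> B \<Longrightarrow> p b = p v"
    using potential_constant_beyond_cut[OF V sep u] by blast
  have sep': "w b a = 0" if "b \<in> B" "a \<in> A" for a b
    using sep[OF that(2,1)] w_sym[of a b] V that by auto
  obtain q where q: "potential z v q" "\<And>a. a \<in> A \<Longrightarrow> q a = q v"
    using potential_constant_beyond_cut[of v B A z] V sep' z by blast
  note q' = potential_minus[OF q(1)]
  show ?thesis
    using res_eq[OF p(1)] res_eq[OF q'] res_eq[OF potential_add[OF p(1) q']] p(2)[OF z] q(2)[OF u]
      V u z by simp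
qed

lemma card_less_if_equal_row_sums:
  assumes V: "V = insert v (A \<union> B)" "v \<notin> A" "v \<notin> B" "A \<inter> B = {}"
    and sep: "\<And>a b. a \<in> A \<Longrightarrow> b \<in> B \<Longrightarrow> w a b = 0"
    and u: "u \<in> A"
    and rows: "(\<Sum>z\<in>V. res u z) = (\<Sum>z\<in>V. res v z)"
  shows "card B < card A"
proof -
  have uv: "u \<in> V" "v \<in> V" "u \<noteq> v"
    using V u by auto
  have AB: "finite A" "finite B" "v \<notin> A \<union> B"
    using V fin by auto
  have split: "(\<Sum>z\<in>V. f z) = f v + (\<Sum>z\<in>A. f z) + (\<Sum>z\<in>B. f z)" for f :: "'a \<Rightarrow> real"
    using AB V(4) unfolding V(1) by (simp add: sum.union_disjoint)
  have "(\<Sum>z\<in>B. res u z) = (\<Sum>z\<in>B. res u v + res v z)"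
    using res_add_across_cut[OF V sep u] by (intro sum.cong) auto
  then have "(\<Sum>z\<in>V. res u z) = res u v + (\<Sum>z\<in>A. res u z) + card B * res u v + (\<Sum>z\<in>B. res v z)"
    by (simp add: split sum.distrib)
  moreover have "(\<Sum>z\<in>V. res v z) = (\<Sum>z\<in>A. res v z) + (\<Sum>z\<in>B. res v z)"
    using uv by (simp add: split res_self)
  moreover have "(\<Sum>z\<in>A. res v z) \<le> (\<Sum>z\<in>A. res u v + res u z)"
    using V uv res_triangle[of v u] res_sym[of v u] by (intro sum_mono) auto
  \<comment> \<open>The extra \<open>1\<close>, which makes the final inequality strict, is the
    entry at \<open>z = v\<close> in the row of \<open>u\<close>.\<close>
  ultimately have "(1 + card B) * res u v \<le> card A * res u v"
    using rows by (simp add: sum.distrib algebra_simps)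
  then show ?thesis
    using res_pos[OF uv] by simp
qed

end

section \<open>Graphs as networks\<close>

text \<open>Induction along an undirected walk; this supplies the assumption \<open>conn\<close> of
  \<open>network\<close>.\<close>

lemma connected_imp_constant:
  assumes "wf_digraph G" "Digraph_Component.connected G"
    and f: "\<And>e. e \<in> arcs G \<Longrightarrow> f (tail G e) = f (head G e)"
    and ab: "a \<in> verts G" "b \<in> verts G"
  shows "f a = f b"
proof -
  have "(a, b) \<in> rtrancl_on (verts G) ((arcs_ends G)\<^sup>s)"
    using assms(2) ab connected_conv[of G] by blast
  then show ?thesis
    by induction (use f in \<open>auto simp: symcl_def arcs_ends_conv\<close>)
qed

text \<open>Take for \<open>A\<close> the component of a vertex that does not reach all others. The
  empty graph also counts as not connected and has to be excluded.\<close>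

lemma not_connected_separation:
  assumes "wf_digraph G" "\<not> Digraph_Component.connected G" "verts G \<noteq> {}"
  obtains A B where "verts G = A \<union> B" "A \<inter> B = {}" "A \<noteq> {}" "B \<noteq> {}"
    "\<forall>e\<in>arcs G. tail G e \<in> A \<longleftrightarrow> head G e \<in> A"
proof -
  let ?R = "rtrancl_on (verts G) ((arcs_ends G)\<^sup>s)"
  obtain a b where ab: "a \<in> verts G" "b \<in> verts G" "(a, b) \<notin> ?R"
    using assms connected_conv[of G] by blast
  define A where "A = {x \<in> verts G. (a, x) \<in> ?R}"
  show thesis
  proof (rule that[of A "verts G - A"])
    show "A \<noteq> {}"
      using ab by (auto simp: A_def)
    show "verts G - A \<noteq> {}"
      using ab by (auto simp: A_def)
  next
    show "\<forall>e\<in>arcs G. tail G e \<in> A \<longleftrightarrow> head G e \<in> A"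
    proof
      fix e
      assume e: "e \<in> arcs G"
      then have "tail G e \<in> verts G" "head G e \<in> verts G"
        using assms(1) by (auto simp: wf_digraph_def)
      moreover have "(tail G e, head G e) \<in> (arcs_ends G)\<^sup>s" "(head G e, tail G e) \<in> (arcs_ends G)\<^sup>s"
        using e by (auto simp: symcl_def arcs_ends_conv)
      ultimately show "tail G e \<in> A \<longleftrightarrow> head G e \<in> A"
        by (auto simp: A_def intro: rtrancl_on_into_rtrancl_on)
    qed
  qed (auto simp: A_def)
qed

theorem theorem2p5:
  fixes G :: "('a, 'b) pre_digraph"
  assumes "Digraph.graph G"
    and "Digraph_Component.connected G"
    and "card (verts G) \<ge> 3"
    and "constant_resistance_curvature G"
  shows "two_connected G"
proof -
  interpret G: graph G
    by (rule assms)
  define w :: "'a \<Rightarrow> 'a \<Rightarrow> real" where "w k l = of_bool ((k, l) \<in> arcs_ends G)" for k l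
  interpret network "verts G" w
  proof
    show "w k l = w l k" for k l
      using G.graph_symmetric by (auto simp: w_def)
    fix f :: "'a \<Rightarrow> real" and a b
    assume f: "\<And>k l. k \<in> verts G \<Longrightarrow> l \<in> verts G \<Longrightarrow> w k l > 0 \<Longrightarrow> f k = f l"
      and ab: "a \<in> verts G" "b \<in> verts G"
    have "f (tail G e) = f (head G e)" if "e \<in> arcs G" for e
      by (rule f) (use that in \<open>auto simp: w_def arcs_ends_conv\<close>)
    then show "f a = f b"
      using connected_imp_constant[OF G.wf_digraph assms(2), of f] ab by blast
  qed (auto simp: w_def)
  have lap: "(\<Sum>e\<in>out_arcs G k. p (tail G e) - p (head G e)) = lap p k" if "k \<in> verts G" for p k
  proof -
    \<comment> \<open>Without parallel arcs, the arcs leaving \<open>k\<close> are indexed by their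
      heads.\<close>
    have inj: "inj_on (head G) (out_arcs G k)"
      using G.no_multi_arcs by (auto simp: inj_on_def out_arcs_def arc_to_ends_def)
    have img: "head G ` out_arcs G k = {l \<in> verts G. (k, l) \<in> arcs_ends G}"
      by (auto simp: out_arcs_def arcs_ends_conv)
    have "(\<Sum>e\<in>out_arcs G k. p (tail G e) - p (head G e)) = (\<Sum>e\<in>out_arcs G k. p k - p (head G e))"
      by (intro sum.cong) (auto simp: out_arcs_def)
    also have "\<dots> = (\<Sum>l | l \<in> verts G \<and> (k, l) \<in> arcs_ends G. p k - p l)"
      using sum.reindex[OF inj, of "\<lambda>l. p k - p l"] by (simp add: img)
    also have "\<dots> = lap p k"
      unfolding lap_def w_def by (intro sum.mono_neutral_cong_left) auto
    finally show ?thesis .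
  qed
  have "unit_current_potential G i j p \<longleftrightarrow> potential i j p" for i j p
    unfolding unit_current_potential_def potential_def using lap by (intro ball_cong) simp_all
  then have res: "resistance_distance G i j = res i j" for i j
    by (simp add: resistance_distance_def res_def)
  let ?\<kappa> = "resistance_curvature G"
  have "card (verts G) \<ge> 2"
    using assms(3) by simp
  from theI'[OF res_curvature_unique_existence[OF this]]
  have \<kappa>: "(\<Sum>j\<in>verts G. res i j * ?\<kappa> j) = 1" if "i \<in> verts G" for i
    using that by (simp add: resistance_curvature_def res)
  have rows: "(\<Sum>z\<in>verts G. res i z) = (\<Sum>z\<in>verts G. res j z)"
    if "i \<in> verts G" "j \<in> verts G" for i j
  proof -
    \<comment> \<open>The common curvature factors out of each row and is nonzero because the
      product is \<open>1\<close>, so it can be cancelled.\<close>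
    have "(\<Sum>z\<in>verts G. res k z) * ?\<kappa> i = 1" if "k \<in> verts G" for k
    proof -
      have "(\<Sum>z\<in>verts G. res k z) * ?\<kappa> i = (\<Sum>z\<in>verts G. res k z * ?\<kappa> z)"
        unfolding sum_distrib_right
        using assms(4)[unfolded constant_resistance_curvature_def] \<open>i \<in> verts G\<close>
        by (intro sum.cong refl) metis
      then show ?thesis
        using \<kappa> that by simp
    qed
    from this[of i] this[of j] that show ?thesis
      by (metis mult_cancel_right mult_zero_right zero_neq_one)
  qed
  have "\<not> cut_vertex G v" for v
  proof
    assume "cut_vertex G v"
    then have v: "v \<in> verts G" and nc: "\<not> Digraph_Component.connected (G.del_vert v)"
      by (auto simp: cut_vertex_def)
    have "verts G \<noteq> {v}"
      using assms(3) by auto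
    then have "verts G - {v} \<noteq> {}"
      using v by auto
    then obtain A B
      where AB: "verts G - {v} = A \<union> B" "A \<inter> B = {}" "A \<noteq> {}" "B \<noteq> {}"
        and arc: "\<forall>e\<in>{a \<in> arcs G. tail G a \<noteq> v \<and> head G a \<noteq> v}. tail G e \<in> A \<longleftrightarrow> head G e \<in> A"
      by (rule not_connected_separation[OF G.wf_digraph_del_vert nc, unfolded G.del_vert_simps])
    have V: "verts G = insert v (A \<union> B)" "verts G = insert v (B \<union> A)" "v \<notin> A" "v \<notin> B"
      using AB v by auto
    have sep: "w a b = 0" "w b a = 0" if "a \<in> A" "b \<in> B" for a b
      using arc AB V that by (auto simp: w_def arcs_ends_conv)
    obtain a b where ab: "a \<in> A" "b \<in> B"
      using AB by blast
    then have "a \<in> verts G" "b \<in> verts G"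
      using V by auto
    \<comment> \<open>Rows \<open>a\<close> and \<open>v\<close> are compared first, then rows
      \<open>b\<close> and \<open>v\<close> with the two sides exchanged.\<close>
    then have "card B < card A" "card A < card B"
      using card_less_if_equal_row_sums[OF V(1,3,4) AB(2) sep(1) ab(1) rows]
        card_less_if_equal_row_sums[OF V(2,4,3) _ sep(2) ab(2) rows] AB(2) v by blast+
    then show False
      by simp
  qed
  then show ?thesis
    using assms by (auto simp: two_connected_def)
qed

end
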